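(* Let $B>0$ and $p\ge 1$, and let $f:[0,\infty)\to[0,\infty)$ be continuous with $f(0)=0$, and differentiable and positive on $(0,B]$. Let $r(x)=f(x)^p/x$ be the efficiency function and $E_f(x)=x f'(x)/f(x)$ the elasticity of $f$. Then an interior maximizer $x^*\in(0,B)$ of the efficiency function $r$ satisfies $E_f(x^* )=1/p$. Moreover, $E_f(x)>1/p$ means that efficiency is locally increasing in $x$, so that deeper practice of fewer skills is locally preferable, whereas $E_f(x)<1/p$ means that efficiency is locally decreasing, so that broader practice of more skills is locally preferable.
   Context: A practice budget $B$ is divided among $n$ skills that share one learning curve $f$: skill $i$ receives practice $x_i\ge 0$, with $\sum_{i=1}^n x_i=B$, and attains skill level $f(x_i)$. The objective is to maximize $\bigl(\sum_{i=1}^n f(x_i)^p\bigr)^{1/p}$, equivalently $\sum_{i=1}^n f(x_i)^p$. The efficiency $r(x)=f(x)^p/x$, for $x>0$, measures effectiveness produced per unit of practice at level $x$; the elasticity $E_f(x)$ is the local percentage gain in skill per percentage gain in practice. Dividing the budget equally among $k$ skills, with no practice for the rest, gives each practiced skill the level $x=B/k$ and total value $\sum_i f(x_i)^p = k\,f(B/k)^p=B\,r(B/k)$; thus deeper practice per skill corresponds to larger $x=B/k$ and hence smaller $k$. *)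

theory Defs
  imports "HOL-Analysis.Analysis"
begin

definition efficiency :: "(real \<Rightarrow> real) \<Rightarrow> real \<Rightarrow> real \<Rightarrow> real" where
  "efficiency f p x = f x powr p / x"

text \<open>
  The derivative is taken relative to the domain \<open>D\<close>, which will be \<open>{0<..B}\<close>. It is the usual
  derivative at interior points, and at \<open>B\<close> it is the left derivative, which is the usual
  derivative whenever \<open>f\<close> is differentiable at \<open>B\<close> from both sides
  (see \<open>elasticity_eq_deriv\<close>).
\<close>

definition elasticity :: "real set \<Rightarrow> (real \<Rightarrow> real) \<Rightarrow> real \<Rightarrow> real" where
  "elasticity D f x = x * vector_derivative f (at x within D) / f x"

lemma elasticity_eq_deriv:
  fixes f :: "real \<Rightarrow> real"
  assumes "f differentiable (at x)" and "0 < x" and "x \<le> B"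
  shows "elasticity {0<..B} f x = x * deriv f x / f x"
proof -
  have "(f has_real_derivative deriv f x) (at x)"
    using assms(1) by (simp add: DERIV_deriv_iff_real_differentiable)
  then have "(f has_vector_derivative deriv f x) (at x within {0..B})"
    by (simp add: has_real_derivative_iff_has_vector_derivative has_vector_derivative_at_within)
  then have hd: "(f has_vector_derivative deriv f x) (at x within {0<..B})"
    by (rule has_vector_derivative_within_subset) auto
  have "x islimpt {0<..<x}"
    using assms by (simp add: islimpt_greaterThanLessThan2)
  then have "x islimpt {0<..B}"
    by (rule islimpt_subset) (use assms in auto)
  then have "at x within {0<..B} \<noteq> bot"
    by (simp add: trivial_limit_within)
  then have "vector_derivative f (at x within {0<..B}) = deriv f x"
    by (rule vector_derivative_within) (rule hd)
  then show ?thesis by (simp add: elasticity_def)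
qed

text \<open>
  Strict increase (decrease) at a point, relative to a domain \<open>D\<close>: nearby points to the left have
  smaller (larger) values and nearby points to the right have larger (smaller) values. For a
  function that is merely differentiable, the sign of the derivative at a single point controls
  this, but not monotonicity on a whole neighbourhood.
\<close>

definition locally_increasing_at :: "real set \<Rightarrow> (real \<Rightarrow> real) \<Rightarrow> real \<Rightarrow> bool" where
  "locally_increasing_at D g x \<longleftrightarrow>
     (\<forall>\<^sub>F y in at x within D. (y < x \<longrightarrow> g y < g x) \<and> (x < y \<longrightarrow> g x < g y))"

definition locally_decreasing_at :: "real set \<Rightarrow> (real \<Rightarrow> real) \<Rightarrow> real \<Rightarrow> bool" where
  "locally_decreasing_at D g x \<longleftrightarrow>
     (\<forall>\<^sub>F y in at x within D. (y < x \<longrightarrow> g x < g y) \<and> (x < y \<longrightarrow> g y < g x))"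

text \<open>
  Total value when the budget \<open>B\<close> is divided equally among \<open>k\<close> skills. The number of skills \<open>k\<close> is
  relaxed to a real number so that local comparisons make sense; for integers it is the value of
  an actual allocation (\<open>sum_equal_split\<close>).
\<close>

definition equal_split_value :: "(real \<Rightarrow> real) \<Rightarrow> real \<Rightarrow> real \<Rightarrow> real \<Rightarrow> real" where
  "equal_split_value f p B k = k * f (B / k) powr p"

lemma sum_equal_split:
  fixes f :: "real \<Rightarrow> real"
  assumes "f 0 = 0" and "k \<le> n"
  shows "(\<Sum>i<n. f (if i < k then B / real k else 0) powr p) = equal_split_value f p B (real k)"
proof -
  have "(\<Sum>i<n. f (if i < k then B / real k else 0) powr p)
      = (\<Sum>i<k. f (if i < k then B / real k else 0) powr p)"
    by (rule sum.mono_neutral_right) (use assms in auto)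
  then show ?thesis by (simp add: equal_split_value_def)
qed

lemma equal_split_value_eq_efficiency:
  assumes "B > 0" and "k > 0"
  shows "equal_split_value f p B k = B * efficiency f p (B / k)"
  using assms by (simp add: equal_split_value_def efficiency_def)

text \<open>
  At practice level \<open>x\<close>, i.e. with \<open>k = B / x\<close> practiced skills, slightly fewer skills (hence a
  level slightly above \<open>x\<close>) give a larger total value and slightly more skills a smaller one;
  respectively the other way round. The constraint \<open>k \<ge> 1\<close> says that the level \<open>B / k\<close> does not
  exceed the budget.
\<close>

definition deeper_locally_preferable :: "(real \<Rightarrow> real) \<Rightarrow> real \<Rightarrow> real \<Rightarrow> real \<Rightarrow> bool" where
  "deeper_locally_preferable f p B x \<longleftrightarrow>
     locally_decreasing_at {1..} (equal_split_value f p B) (B / x)"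

definition broader_locally_preferable :: "(real \<Rightarrow> real) \<Rightarrow> real \<Rightarrow> real \<Rightarrow> real \<Rightarrow> bool" where
  "broader_locally_preferable f p B x \<longleftrightarrow>
     locally_increasing_at {1..} (equal_split_value f p B) (B / x)"

end

theory Submission
  imports Defs
begin

text \<open>
  Where \<open>f\<close> is positive, \<open>r'(x) = (r(x) / x) (p E\<^sub>f(x) - 1)\<close>, so the sign of
  \<open>E\<^sub>f(x) - 1/p\<close> is the sign of \<open>r'(x)\<close>. This yields the first-order condition and the
  monotonicity of \<open>r\<close>, locally and on intervals. Since the total value of an equal split among
  \<open>k\<close> skills is \<open>B r(B/k)\<close> and \<open>k \<mapsto> B/k\<close> reverses the order, the statements about the
  number of practiced skills follow.
\<close>

lemma efficiency_pos: "x > 0 \<Longrightarrow> f x > 0 \<Longrightarrow> efficiency f p x > 0"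
  by (simp add: efficiency_def)

text \<open>This is the quotient rule combined with the power rule. Positivity of \<open>f x\<close>
  makes the power differentiable there and lets \<open>f x powr (p - 1)\<close> be written as
  \<open>f x powr p / f x\<close>, so that \<open>efficiency f p x / x\<close> factors out and the
  elasticity quotient \<open>x * d / f x\<close> remains.\<close>

lemma has_real_derivative_efficiency:
  assumes "(f has_real_derivative d) (at x within D)" and "x > 0" and "f x > 0"
  shows "(efficiency f p has_real_derivative
           efficiency f p x / x * (p * (x * d / f x) - 1)) (at x within D)"
proof -
  have "((\<lambda>y. f y powr p / y) has_real_derivative
          f x powr p / x / x * (p * (x * d / f x) - 1)) (at x within D)"
    using assms
    by (auto intro!: derivative_eq_intros simp: powr_diff field_simps power2_eq_square)
  then show ?thesis
    by (simp add: efficiency_def [abs_def])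
qed

lemma has_real_derivative_efficiency_elasticity:
  assumes "f differentiable_on {0<..B}" and "x \<in> {0<..B}" and "f x > 0"
  shows "(efficiency f p has_real_derivative
           efficiency f p x / x * (p * elasticity {0<..B} f x - 1)) (at x within {0<..B})"
proof -
  have "f differentiable (at x within {0<..B})"
    using assms by (simp add: differentiable_on_def)
  then have "(f has_real_derivative vector_derivative f (at x within {0<..B}))
      (at x within {0<..B})"
    by (simp add: vector_derivative_works has_real_derivative_iff_has_vector_derivative)
  from has_real_derivative_efficiency [OF this] show ?thesis
    using assms by (simp add: elasticity_def)
qed

text \<open>Difference quotients at \<open>x\<close> are eventually positive, which compares
  \<open>g y\<close> with \<open>g x\<close> but not two nearby values with each other. Each side of
  \<open>x\<close> has its own radius, and the minimum of the two serves both.\<close>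

lemma locally_increasing_at_if_deriv_pos:
  assumes "(g has_real_derivative l) (at x within D)" and "l > 0"
  shows "locally_increasing_at D g x"
proof -
  obtain d where d: "d > 0" "\<And>h. h > 0 \<Longrightarrow> x + h \<in> D \<Longrightarrow> h < d \<Longrightarrow> g x < g (x + h)"
    using has_real_derivative_pos_inc_right [OF assms] by blast
  obtain e where e: "e > 0" "\<And>h. h > 0 \<Longrightarrow> x - h \<in> D \<Longrightarrow> h < e \<Longrightarrow> g (x - h) < g x"
    using has_real_derivative_pos_inc_left [OF assms] by blast
  have "(y < x \<longrightarrow> g y < g x) \<and> (x < y \<longrightarrow> g x < g y)"
    if "y \<in> D" "dist y x < min d e" for y
    using that d(2) [of "y - x"] e(2) [of "x - y"] by (auto simp: dist_real_def)
  then show ?thesis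
    unfolding locally_increasing_at_def eventually_at
    using d(1) e(1) by (intro exI [of _ "min d e"]) auto
qed

lemma locally_decreasing_at_iff_uminus:
  "locally_decreasing_at D g x \<longleftrightarrow> locally_increasing_at D (\<lambda>y. - g y) x"
  by (simp add: locally_increasing_at_def locally_decreasing_at_def)

lemma locally_decreasing_at_if_deriv_neg:
  assumes "(g has_real_derivative l) (at x within D)" and "l < 0"
  shows "locally_decreasing_at D g x"
  unfolding locally_decreasing_at_iff_uminus
  by (rule locally_increasing_at_if_deriv_pos [where l = "- l"])
    (use assms in \<open>auto intro: DERIV_minus\<close>)

text \<open>This transports eventual statements about levels near \<open>x\<close> to numbers of
  skills near \<open>B / x\<close>. The bound \<open>k \<ge> 1\<close> keeps the level
  \<open>B / k\<close> within the budget, and injectivity of \<open>k \<mapsto> B / k\<close> keeps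
  it different from \<open>x\<close>, as the punctured filter demands.\<close>

lemma filterlim_budget_divide:
  fixes B x :: real
  assumes "x \<in> {0<..B}"
  shows "filterlim (\<lambda>k. B / k) (at x within {0<..B}) (at (B / x) within {1..})"
  unfolding filterlim_at
proof
  have "((\<lambda>k. B / k) \<longlongrightarrow> B / (B / x)) (at (B / x) within {1..})"
    using assms by (intro tendsto_intros) auto
  then show "((\<lambda>k. B / k) \<longlongrightarrow> x) (at (B / x) within {1..})"
    using assms by simp
  show "\<forall>\<^sub>F k in at (B / x) within {1..}. B / k \<in> {0<..B} \<and> B / k \<noteq> x"
    unfolding eventually_at_filter
    by (rule always_eventually) (use assms in \<open>auto simp: field_simps\<close>)
qed

text \<open>Local increase of the efficiency is pulled back along \<open>k \<mapsto> B / k\<close>.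
  This map reverses the order, so increase in the level becomes decrease in the number of
  skills.\<close>

lemma deeper_locally_preferable_if_increasing:
  assumes "x \<in> {0<..B}" and "locally_increasing_at {0<..B} (efficiency f p) x"
  shows "deeper_locally_preferable f p B x"
proof -
  let ?r = "efficiency f p"
  have "\<forall>\<^sub>F k in at (B / x) within {1..}.
      (B / k < x \<longrightarrow> ?r (B / k) < ?r x) \<and> (x < B / k \<longrightarrow> ?r x < ?r (B / k))"
    using assms(2) filterlim_budget_divide [OF assms(1)]
    unfolding locally_increasing_at_def by (rule eventually_compose_filterlim)
  \<comment> \<open>Membership gives \<open>k > 0\<close>, needed both to turn
    \<open>k < B / x\<close> into \<open>x < B / k\<close> and to express the total value through
    the efficiency.\<close>
  moreover have "\<forall>\<^sub>F k in at (B / x) within {1..}. k \<in> {1..}"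
    by (simp add: eventually_at_filter)
  ultimately show ?thesis
    unfolding deeper_locally_preferable_def locally_decreasing_at_def
    by eventually_elim
      (use assms(1) in \<open>auto simp: equal_split_value_eq_efficiency field_simps\<close>)
qed

lemma broader_locally_preferable_if_decreasing:
  assumes "x \<in> {0<..B}" and "locally_decreasing_at {0<..B} (efficiency f p) x"
  shows "broader_locally_preferable f p B x"
proof -
  let ?r = "efficiency f p"
  have "\<forall>\<^sub>F k in at (B / x) within {1..}.
      (B / k < x \<longrightarrow> ?r x < ?r (B / k)) \<and> (x < B / k \<longrightarrow> ?r (B / k) < ?r x)"
    using assms(2) filterlim_budget_divide [OF assms(1)]
    unfolding locally_decreasing_at_def by (rule eventually_compose_filterlim)
  moreover have "\<forall>\<^sub>F k in at (B / x) within {1..}. k \<in> {1..}"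
    by (simp add: eventually_at_filter)
  ultimately show ?thesis
    unfolding broader_locally_preferable_def locally_increasing_at_def
    by eventually_elim
      (use assms(1) in \<open>auto simp: equal_split_value_eq_efficiency field_simps\<close>)
qed

text \<open>The numbers of skills considered are the positive preimages of \<open>S\<close> under
  the order-reversing map \<open>k \<mapsto> B / k\<close>; multiplying the efficiency by
  \<open>B > 0\<close> preserves strict inequalities.\<close>

lemma strict_antimono_on_equal_split_value:
  assumes "B > 0" and "strict_mono_on S (efficiency f p)"
  shows "strict_antimono_on {k. k > 0 \<and> B / k \<in> S} (equal_split_value f p B)"
proof (rule monotone_onI)
  fix k l assume "k \<in> {k. k > 0 \<and> B / k \<in> S}" "l \<in> {k. k > 0 \<and> B / k \<in> S}" "k < l"
  moreover from this have "B / l < B / k"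
    using assms(1) by (simp add: divide_strict_left_mono)
  ultimately have "efficiency f p (B / l) < efficiency f p (B / k)"
    using monotone_onD [OF assms(2)] by simp
  with \<open>k \<in> _\<close> \<open>l \<in> _\<close> show "equal_split_value f p B l < equal_split_value f p B k"
    using assms(1) by (simp add: equal_split_value_eq_efficiency)
qed

lemma strict_mono_on_equal_split_value:
  assumes "B > 0" and "strict_antimono_on S (efficiency f p)"
  shows "strict_mono_on {k. k > 0 \<and> B / k \<in> S} (equal_split_value f p B)"
proof (rule monotone_onI)
  fix k l assume "k \<in> {k. k > 0 \<and> B / k \<in> S}" "l \<in> {k. k > 0 \<and> B / k \<in> S}" "k < l"
  moreover from this have "B / l < B / k"
    using assms(1) by (simp add: divide_strict_left_mono)
  ultimately have "efficiency f p (B / k) < efficiency f p (B / l)"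
    using monotone_onD [OF assms(2)] by simp
  with \<open>k \<in> _\<close> \<open>l \<in> _\<close> show "equal_split_value f p B k < equal_split_value f p B l"
    using assms(1) by (simp add: equal_split_value_eq_efficiency)
qed

text \<open>This rests on the mean value theorem on \<open>{a..b}\<close>, which needs two-sided
  derivatives only strictly inside and mere continuity at the ends. One-sided derivatives at
  endpoints of \<open>S\<close> therefore suffice.\<close>

lemma strict_mono_on_if_deriv_pos:
  fixes g g' :: "real \<Rightarrow> real"
  assumes "is_interval S"
    and deriv: "\<And>x. x \<in> S \<Longrightarrow> (g has_real_derivative g' x) (at x within S)"
    and pos: "\<And>x. x \<in> S \<Longrightarrow> g' x > 0"
  shows "strict_mono_on S g"
proof (rule monotone_onI)
  fix a b assume ab: "a \<in> S" "b \<in> S" "a < b"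
  have sub: "{a..b} \<subseteq> S"
    using mem_is_interval_1_I [OF assms(1) ab(1,2)] by auto
  show "g a < g b"
  proof (rule DERIV_pos_imp_increasing_open [OF \<open>a < b\<close>])
    fix x assume x: "a < x" "x < b"
    then have "(g has_real_derivative g' x) (at x within {a<..<b})"
      using sub by (intro DERIV_subset [OF deriv]) auto
    \<comment> \<open>On an open interval the relative derivative is the ordinary one.\<close>
    moreover have "at x within {a<..<b} = at x"
      using x by (intro at_within_open) auto
    ultimately show "\<exists>y. (g has_real_derivative y) (at x) \<and> 0 < y"
      using pos [of x] x subsetD [OF sub, of x] by auto
  next
    show "continuous_on {a..b} g"
      using sub by (intro DERIV_continuous_on [where D = g'] DERIV_subset [OF deriv]) auto
  qed
qed

lemma strict_antimono_on_if_deriv_neg: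
  fixes g g' :: "real \<Rightarrow> real"
  assumes "is_interval S"
    and "\<And>x. x \<in> S \<Longrightarrow> (g has_real_derivative g' x) (at x within S)"
    and "\<And>x. x \<in> S \<Longrightarrow> g' x < 0"
  shows "strict_antimono_on S g"
proof -
  have "strict_mono_on S (\<lambda>x. - g x)"
    by (rule strict_mono_on_if_deriv_pos [where g' = "\<lambda>x. - g' x"])
      (use assms in \<open>auto intro: DERIV_minus\<close>)
  then show ?thesis
    by (simp add: monotone_on_def)
qed

theorem proposition5p6:
  fixes f :: "real \<Rightarrow> real" and B p :: real
  assumes "B > 0" and "p \<ge> 1"
    and "\<forall>x\<ge>0. f x \<ge> 0"
    and "continuous_on {0..} f"
    and "f 0 = 0"
    and "f differentiable_on {0<..B}"
    and "\<forall>x\<in>{0<..B}. f x > 0"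
  shows "(\<forall>x\<in>{0<..<B}. (\<forall>y\<in>{0<..B}. efficiency f p y \<le> efficiency f p x)
             \<longrightarrow> elasticity {0<..B} f x = 1 / p)
       \<and> (\<forall>x\<in>{0<..B}. elasticity {0<..B} f x > 1 / p
             \<longrightarrow> locally_increasing_at {0<..B} (efficiency f p) x
               \<and> deeper_locally_preferable f p B x)
       \<and> (\<forall>x\<in>{0<..B}. elasticity {0<..B} f x < 1 / p
             \<longrightarrow> locally_decreasing_at {0<..B} (efficiency f p) x
               \<and> broader_locally_preferable f p B x)
       \<and> (\<forall>S. S \<subseteq> {0<..B} \<and> is_interval S \<and> (\<forall>x\<in>S. elasticity {0<..B} f x > 1 / p)
             \<longrightarrow> strict_mono_on S (efficiency f p)
               \<and> strict_antimono_on {k. k > 0 \<and> B / k \<in> S} (equal_split_value f p B))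
       \<and> (\<forall>S. S \<subseteq> {0<..B} \<and> is_interval S \<and> (\<forall>x\<in>S. elasticity {0<..B} f x < 1 / p)
             \<longrightarrow> strict_antimono_on S (efficiency f p)
               \<and> strict_mono_on {k. k > 0 \<and> B / k \<in> S} (equal_split_value f p B))"
proof -
  let ?D = "{0<..B}" and ?r = "efficiency f p"
  let ?E = "elasticity ?D f"
  define r' where "r' x = ?r x / x * (p * ?E x - 1)" for x
  have r': "(?r has_real_derivative r' x) (at x within ?D)" if "x \<in> ?D" for x
    unfolding r'_def using has_real_derivative_efficiency_elasticity assms that by blast
  have pos: "?r x / x > 0" if "x \<in> ?D" for x
    using assms that by (simp add: efficiency_pos)
  have r'_pos: "r' x > 0" if "x \<in> ?D" "?E x > 1 / p" for x
    unfolding r'_def using pos [OF that(1)] that(2) \<open>p \<ge> 1\<close>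
    by (intro mult_pos_pos) (auto simp: field_simps)
  have r'_neg: "r' x < 0" if "x \<in> ?D" "?E x < 1 / p" for x
    unfolding r'_def using pos [OF that(1)] that(2) \<open>p \<ge> 1\<close>
    by (intro mult_pos_neg) (auto simp: field_simps)
  have critical: "?E x = 1 / p"
    if x: "x \<in> {0<..<B}" and max: "\<forall>y\<in>?D. ?r y \<le> ?r x" for x
  proof -
    have "(?r has_real_derivative r' x) (at x within {0<..<B})"
      using x by (intro DERIV_subset [OF r']) auto
    moreover have "at x within {0<..<B} = at x"
      using x by (intro at_within_open) auto
    ultimately have "(?r has_real_derivative r' x) (at x)"
      by simp
    \<comment> \<open>The radius is the distance from \<open>x\<close> to the nearer end of the
      interval, so every such \<open>y\<close> stays in \<open>{0<..<B}\<close>, where the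
      maximality of \<open>x\<close> applies.\<close>
    moreover have "?r y \<le> ?r x" if "\<bar>x - y\<bar> < min x (B - x)" for y
      using that by (intro max [rule_format]) auto
    ultimately have "r' x = 0"
      using x by (intro DERIV_local_max [where d = "min x (B - x)"]) auto
    \<comment> \<open>The factor \<open>?r x / x\<close> of \<open>r' x\<close> is nonzero, so
      \<open>p * ?E x - 1\<close> must vanish.\<close>
    then show ?thesis
      using pos [of x] x \<open>p \<ge> 1\<close> by (auto simp: r'_def field_simps)
  qed
  have r'_subset: "(?r has_real_derivative r' x) (at x within S)" if "S \<subseteq> ?D" "x \<in> S" for S x
    using r' DERIV_subset that by blast
  \<comment> \<open>A constant sign of the derivative throughout an interval compares any two of its
    points, which the sign at a single point cannot do.\<close>
  have mono: "strict_mono_on S ?r"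
    if "S \<subseteq> ?D" "is_interval S" "\<forall>x\<in>S. ?E x > 1 / p" for S
    using that r'_pos r'_subset by (intro strict_mono_on_if_deriv_pos [where g' = r']) auto
  have antimono: "strict_antimono_on S ?r"
    if "S \<subseteq> ?D" "is_interval S" "\<forall>x\<in>S. ?E x < 1 / p" for S
    using that r'_neg r'_subset by (intro strict_antimono_on_if_deriv_neg [where g' = r']) auto
  have increasing: "locally_increasing_at ?D ?r x" if "x \<in> ?D" "?E x > 1 / p" for x
    using locally_increasing_at_if_deriv_pos r' r'_pos that by blast
  have decreasing: "locally_decreasing_at ?D ?r x" if "x \<in> ?D" "?E x < 1 / p" for x
    using locally_decreasing_at_if_deriv_neg r' r'_neg that by blast
  note deeper = deeper_locally_preferable_if_increasing
  note broader = broader_locally_preferable_if_decreasing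
  note split_antimono = strict_antimono_on_equal_split_value [OF \<open>B > 0\<close>]
  note split_mono = strict_mono_on_equal_split_value [OF \<open>B > 0\<close>]
  have "\<forall>x\<in>{0<..<B}. (\<forall>y\<in>?D. ?r y \<le> ?r x) \<longrightarrow> ?E x = 1 / p"
    using critical by blast
  moreover have "\<forall>x\<in>?D. ?E x > 1 / p \<longrightarrow>
      locally_increasing_at ?D ?r x \<and> deeper_locally_preferable f p B x"
    using increasing deeper by blast
  moreover have "\<forall>x\<in>?D. ?E x < 1 / p \<longrightarrow>
      locally_decreasing_at ?D ?r x \<and> broader_locally_preferable f p B x"
    using decreasing broader by blast
  moreover have "\<forall>S. S \<subseteq> ?D \<and> is_interval S \<and> (\<forall>x\<in>S. ?E x > 1 / p) \<longrightarrow>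
      strict_mono_on S ?r \<and>
      strict_antimono_on {k. k > 0 \<and> B / k \<in> S} (equal_split_value f p B)"
    using mono split_antimono by blast
  moreover have "\<forall>S. S \<subseteq> ?D \<and> is_interval S \<and> (\<forall>x\<in>S. ?E x < 1 / p) \<longrightarrow>
      strict_antimono_on S ?r \<and>
      strict_mono_on {k. k > 0 \<and> B / k \<in> S} (equal_split_value f p B)"
    using antimono split_mono by blast
  ultimately show ?thesis
    by (intro conjI)
qed

end
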